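(* Let $d\ge 1$ and let $M_1,M_2\subset\mathbb{R}^d$ be closed, disjoint, strictly convex sets such that $M_1\cup M_2$ is centrally symmetric, i.e. $x\in M_1\cup M_2$ if and only if $-x\in M_1\cup M_2$. The sets are not assumed to be bounded. Let $V_1,V_2$ be random vectors in $\mathbb{R}^d$ (the velocities), and let $T$ and $C$ be the collision time and collision location of the moving sets $M_1+sV_1$ and $M_2+sV_2$, $s\ge 0$. If the distribution of $(V_1,V_2)/|(V_1,V_2)|$ is uniform on the unit sphere in $\mathbb{R}^{2d}$, then the conditional distribution of $C$ given $T<\infty$ is rotation invariant, i.e. invariant under the action of the orthogonal group $O(d)$.
   Context: Write $M_i(s)=M_i+sV_i$ for $i=1,2$ and $s\ge 0$. The collision time is $T=\inf\{t\ge 0: M_1(t)\cap M_2(t)\neq\emptyset\}$ (with $\inf\emptyset=\infty$); $T<\infty$ indicates that there is a collision. The collision location $C$ is defined by $\{C\}=M_1(T)\cap M_2(T)$; this intersection contains only one point by the strict convexity of $M_1$ and $M_2$. A closed set $M$ is strictly convex if for any two distinct points of $M$ the open segment between them lies in the interior of $M$. Here $|\cdot|$ is the Euclidean norm. *)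

theory Defs
  imports "HOL-Probability.Probability"
begin

definition strictly_convex :: "'a::euclidean_space set \<Rightarrow> bool" where
  "strictly_convex M \<longleftrightarrow>
     (\<forall>x\<in>M. \<forall>y\<in>M. x \<noteq> y \<longrightarrow> open_segment x y \<subseteq> interior M)"

definition moved :: "'a::euclidean_space set \<Rightarrow> 'a \<Rightarrow> real \<Rightarrow> 'a set" where
  "moved M v s = (\<lambda>x. x + s *\<^sub>R v) ` M"

(* In ereal the infimum of the empty set is \<infinity>. *)
definition collision_time ::
  "'a::euclidean_space set \<Rightarrow> 'a set \<Rightarrow> 'a \<Rightarrow> 'a \<Rightarrow> ereal" where
  "collision_time M1 M2 v1 v2 =
     Inf (ereal ` {t. 0 \<le> t \<and> moved M1 v1 t \<inter> moved M2 v2 t \<noteq> {}})"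

(* Only meaningful when the collision time is finite; otherwise the value is arbitrary. *)
definition collision_location ::
  "'a::euclidean_space set \<Rightarrow> 'a set \<Rightarrow> 'a \<Rightarrow> 'a \<Rightarrow> 'a" where
  "collision_location M1 M2 v1 v2 =
     (let T = real_of_ereal (collision_time M1 M2 v1 v2)
      in THE c. moved M1 v1 T \<inter> moved M2 v2 T = {c})"

(* Normalized surface measure of the unit sphere, regarded as a Borel measure on the
   whole space: the mass of a set A of directions is the normalized volume of the cone
   {r *\<^sub>R u | 0 < r < 1, u \<in> A}, so it is the image of the uniform distribution on the
   unit ball under radial projection.  The null set {0} is mapped to 0. *)
definition uniform_sphere :: "'a::euclidean_space measure" where
  "uniform_sphere = distr (uniform_measure lborel (ball 0 1)) borel (\<lambda>x. x /\<^sub>R norm x)"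

definition rotation_invariant :: "'a::euclidean_space measure \<Rightarrow> bool" where
  "rotation_invariant \<mu> \<longleftrightarrow>
     (\<forall>g. orthogonal_transformation g \<longrightarrow> distr \<mu> borel g = \<mu>)"

(* Conditional distribution of X given an event A of positive probability.  If A has
   probability 0, uniform_measure P A is the null measure, and so is cond_distr P A X. *)
definition cond_distr ::
  "'w measure \<Rightarrow> 'w set \<Rightarrow> ('w \<Rightarrow> 'a::euclidean_space) \<Rightarrow> 'a measure" where
  "cond_distr P A X = distr (uniform_measure P A) borel X"

end

theory Submission
  imports Defs
begin

text \<open>If neither set is empty, connectedness and symmetry force \<open>M2 = - M1\<close>. Put
  \<open>w = (v2 - v1) / 2\<close> and \<open>s = (v1 + v2) / 2\<close>. By convexity \<open>M1 + t v1\<close> and \<open>M2 + t v2\<close> meet iff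
  \<open>t w \<in> M1\<close>, so the collision time \<open>T\<close> depends on \<open>w\<close> alone, and strict convexity gives \<open>C = T s\<close>.
  Replacing \<open>s\<close> by \<open>g s\<close> for an orthogonal \<open>g\<close> is an orthogonal map of the pair \<open>(v1, v2)\<close>;
  it preserves the uniform distribution on the sphere and turns \<open>C\<close> into \<open>g C\<close>.\<close>

section \<open>Orthogonal invariance of Lebesgue measure and of the uniform distribution on the
  sphere\<close>

lemma nn_integral_lborel_translate:
  fixes f :: "'a::euclidean_space \<Rightarrow> ennreal"
  assumes [measurable]: "f \<in> borel_measurable borel"
  shows "(\<integral>\<^sup>+x. f (c + x) \<partial>lborel) = (\<integral>\<^sup>+x. f x \<partial>lborel)"
proof -
  have "(\<integral>\<^sup>+x. f x \<partial>lborel) = (\<integral>\<^sup>+x. f x \<partial>distr lborel borel ((+) c))"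
    by (simp add: lborel_distr_plus)
  also have "\<dots> = (\<integral>\<^sup>+x. f (c + x) \<partial>lborel)"
    by (subst nn_integral_distr) auto
  finally show ?thesis ..
qed

lemma borel_measurable_orthogonal_transformation:
  fixes f :: "'a::euclidean_space \<Rightarrow> 'a"
  assumes "orthogonal_transformation f" shows "f \<in> borel_measurable borel"
  using assms by (auto simp: orthogonal_transformation linear_conv_bounded_linear
      intro!: borel_measurable_continuous_onI linear_continuous_on)

text \<open>The usual uniqueness argument for Haar measure: both sides, multiplied by the volume of
  the unit ball \<open>B\<close>, equal the double integral of \<open>1\<^sub>B(x) 1\<^sub>A(f y + x)\<close>.\<close>

lemma emeasure_lborel_orthogonal_vimage:
  fixes f :: "'a::euclidean_space \<Rightarrow> 'a"
  assumes f: "orthogonal_transformation f" and [measurable]: "A \<in> sets borel"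
  shows "emeasure lborel (f -` A) = emeasure lborel A"
proof -
  have lin: "linear f" and norm: "norm (f x) = norm x" for x
    using f by (auto simp: orthogonal_transformation)
  have surj: "surj f"
    using f by (rule orthogonal_transformation_surj)
  have fm [measurable]: "f \<in> borel_measurable borel"
    using f by (rule borel_measurable_orthogonal_transformation)
  have [measurable]: "f -` A \<in> sets borel"
    using measurable_sets_borel[OF fm \<open>A \<in> sets borel\<close>] by simp
  let ?B = "ball (0::'a) 1"
  have [measurable]: "?B \<in> sets borel"
    by simp
  let ?I = "\<lambda>S x. indicator S x :: ennreal"
  \<comment> \<open>Writing \<open>x\<close> as \<open>f z\<close> turns \<open>f y + x\<close> into
    \<open>f (z + y)\<close>, a translation inside the preimage of \<open>A\<close>.\<close>
  have left: "(\<integral>\<^sup>+y. ?I A (f y + x) \<partial>lborel) = emeasure lborel (f -` A)" for x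
  proof -
    obtain z where z: "f z = x"
      using surj by (metis surjD)
    have "(\<integral>\<^sup>+y. ?I A (f y + x) \<partial>lborel) = (\<integral>\<^sup>+y. ?I (f -` A) (z + y) \<partial>lborel)"
      by (intro nn_integral_cong) (simp add: indicator_def linear_add[OF lin] z add.commute)
    also have "\<dots> = emeasure lborel (f -` A)"
      by (subst nn_integral_lborel_translate) auto
    finally show ?thesis .
  qed
  have right: "(\<integral>\<^sup>+y. ?I ?B (x - f y) \<partial>lborel) = emeasure lborel ?B" for x
  proof -
    obtain z where z: "f z = x"
      using surj by (metis surjD)
    have "norm (x - f y) = norm (- z + y)" for y
      by (metis linear_diff[OF lin] z norm norm_minus_commute uminus_add_conv_diff)
    then have "(\<integral>\<^sup>+y. ?I ?B (x - f y) \<partial>lborel) = (\<integral>\<^sup>+y. ?I ?B (- z + y) \<partial>lborel)"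
      by (intro nn_integral_cong) (simp add: indicator_def)
    also have "\<dots> = (\<integral>\<^sup>+y. ?I ?B y \<partial>lborel)"
      by (intro nn_integral_lborel_translate borel_measurable_indicator) simp
    also have "\<dots> = emeasure lborel ?B"
      by simp
    finally show ?thesis .
  qed
  have "emeasure lborel ?B * emeasure lborel (f -` A)
      = (\<integral>\<^sup>+x. \<integral>\<^sup>+y. ?I ?B x * ?I A (f y + x) \<partial>lborel \<partial>lborel)"
  proof -
    have "(\<integral>\<^sup>+x. ?I ?B x * emeasure lborel (f -` A) \<partial>lborel)
        = (\<integral>\<^sup>+x. ?I ?B x \<partial>lborel) * emeasure lborel (f -` A)"
      by (intro nn_integral_multc borel_measurable_indicator) simp
    then show ?thesis
      by (simp add: nn_integral_cmult left)
  qed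
  also have "\<dots> = (\<integral>\<^sup>+y. \<integral>\<^sup>+x. ?I ?B x * ?I A (f y + x) \<partial>lborel \<partial>lborel)"
    by (rule lborel_pair.Fubini') measurable
  \<comment> \<open>Shifting \<open>x\<close> by \<open>f y\<close> moves the dependence on
    \<open>y\<close> from \<open>A\<close> to the ball; the \<open>y\<close> with
    \<open>x - f y\<close> in the ball again form a unit ball, since \<open>f\<close> preserves
    norms.\<close>
  also have "\<dots> = (\<integral>\<^sup>+y. \<integral>\<^sup>+x. ?I ?B (x - f y) * ?I A x \<partial>lborel \<partial>lborel)"
  proof (rule nn_integral_cong)
    fix y
    show "(\<integral>\<^sup>+x. ?I ?B x * ?I A (f y + x) \<partial>lborel)
        = (\<integral>\<^sup>+x. ?I ?B (x - f y) * ?I A x \<partial>lborel)"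
      using nn_integral_lborel_translate[of "\<lambda>x. ?I ?B (x - f y) * ?I A x" "f y"] by simp
  qed
  also have "\<dots> = (\<integral>\<^sup>+x. \<integral>\<^sup>+y. ?I ?B (x - f y) * ?I A x \<partial>lborel \<partial>lborel)"
    by (rule lborel_pair.Fubini') measurable
  also have "\<dots> = emeasure lborel ?B * emeasure lborel A"
    by (simp add: nn_integral_multc right nn_integral_cmult)
  finally have "emeasure lborel ?B * emeasure lborel (f -` A) = emeasure lborel ?B * emeasure lborel A" .
  \<comment> \<open>Cancelling a factor in \<open>ennreal\<close> requires it to be neither 0 nor
    infinite.\<close>
  moreover have "emeasure lborel ?B \<noteq> 0"
    using open_not_negligible[of ?B] by (auto simp: negligible_iff_null_sets null_sets_def)
  moreover have "emeasure lborel ?B \<noteq> \<infinity>"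
    using emeasure_lborel_ball_finite[of "0::'a" 1] by simp
  ultimately show ?thesis
    by (simp add: ennreal_mult_cancel_left)
qed

text \<open>An orthogonal map commutes with radial projection and preserves the unit ball, so the
  cone over the preimage of \<open>A\<close> is the preimage of the cone over \<open>A\<close>, and
  the Lebesgue case applies.\<close>

lemma emeasure_uniform_sphere_orthogonal_vimage:
  fixes f :: "'a::euclidean_space \<Rightarrow> 'a"
  assumes f: "orthogonal_transformation f" and A [measurable]: "A \<in> sets borel"
  shows "emeasure uniform_sphere (f -` A) = emeasure uniform_sphere A"
proof -
  have lin: "linear f" and norm: "norm (f x) = norm x" for x
    using f by (auto simp: orthogonal_transformation)
  have fm: "f \<in> borel_measurable borel"
    using f by (rule borel_measurable_orthogonal_transformation)
  have fA [measurable]: "f -` A \<in> sets borel"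
    using measurable_sets_borel[OF fm A] by simp
  let ?B = "ball (0::'a) 1" and ?r = "\<lambda>x::'a. x /\<^sub>R norm x"
  have r: "?r \<in> borel_measurable borel"
    by measurable
  have rS: "?r -` S \<in> sets borel" if "S \<in> sets borel" for S
    using measurable_sets_borel[OF r that] by simp
  have eq: "emeasure uniform_sphere S = emeasure lborel (?B \<inter> ?r -` S) / emeasure lborel ?B"
    if "S \<in> sets borel" for S
    using that rS[OF that] by (simp add: uniform_sphere_def emeasure_distr)
  have "?B \<inter> ?r -` f -` A = f -` (?B \<inter> ?r -` A)"
    by (auto simp: norm linear_cmul[OF lin])
  moreover have "?B \<inter> ?r -` A \<in> sets borel"
    using rS[OF A] by auto
  ultimately show ?thesis
    by (simp only: eq[OF fA] eq[OF A] emeasure_lborel_orthogonal_vimage[OF f])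
qed

section \<open>Convexity and central symmetry of the union\<close>

lemma strictly_convex_imp_convex:
  assumes "strictly_convex M" shows "convex M"
proof -
  have "open_segment x y \<subseteq> M" if "x \<in> M" "y \<in> M" for x y
    using assms that interior_subset[of M] by (cases "x = y") (auto simp: strictly_convex_def)
  then show ?thesis
    by (force simp: convex_contains_open_segment)
qed

lemma zero_in_convex_symmetric:
  assumes "convex M" "x \<in> M" "- x \<in> M" shows "0 \<in> M"
  using convexD[OF assms, of "1/2" "1/2"] by simp

text \<open>Each set is connected and covered by the disjoint closed reflections of
  \<open>M1\<close> and \<open>M2\<close>, so its own reflection lies wholly in \<open>M1\<close> or
  wholly in \<open>M2\<close>. A nonempty convex set closed under negation contains 0, so
  disjointness forbids both sets from being of that kind.\<close>

lemma centrally_symmetric_union_cases: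
  fixes M1 M2 :: "'a::real_normed_vector set"
  assumes cl: "closed M1" "closed M2" and disj: "M1 \<inter> M2 = {}"
    and cv: "convex M1" "convex M2"
    and sym: "\<And>x. x \<in> M1 \<union> M2 \<longleftrightarrow> - x \<in> M1 \<union> M2"
    and ne: "M1 \<noteq> {}" "M2 \<noteq> {}"
  shows "M2 = uminus ` M1"
proof -
  have cases: "(\<forall>x\<in>M. - x \<in> M1) \<or> (\<forall>x\<in>M. - x \<in> M2)" if "M = M1 \<or> M = M2" for M
  proof -
    have "uminus ` M1 \<inter> M = {} \<or> uminus ` M2 \<inter> M = {}"
    proof (rule connected_closedD)
      show "connected M"
        using that cv by (auto intro: convex_connected)
      show "uminus ` M1 \<inter> uminus ` M2 \<inter> M = {}"
        using disj by auto
      show "M \<subseteq> uminus ` M1 \<union> uminus ` M2"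
      proof
        fix x assume "x \<in> M"
        then have "- x \<in> M1 \<union> M2"
          using that sym[of x] by auto
        then show "x \<in> uminus ` M1 \<union> uminus ` M2"
          by (auto simp: image_iff) (metis minus_minus)+
      qed
      show "closed (uminus ` M1)" "closed (uminus ` M2)"
        using cl by (simp_all add: closed_negations)
    qed
    then have "(\<forall>x\<in>M. - x \<notin> M1) \<or> (\<forall>x\<in>M. - x \<notin> M2)"
      by (metis IntI empty_iff image_eqI minus_minus)
    moreover have "- x \<in> M1 \<or> - x \<in> M2" if "x \<in> M" for x
      using \<open>M = M1 \<or> M = M2\<close> that sym[of x] by auto
    ultimately show ?thesis
      by blast
  qed
  have half: "\<forall>x\<in>N. - x \<in> M" if MN: "M = M1 \<and> N = M2 \<or> M = M2 \<and> N = M1" for M N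
  proof (rule ccontr)
    assume "\<not> ?thesis"
    then have N: "- x \<in> N" if "x \<in> N" for x
      using cases[of N] MN that by auto
    moreover have "N \<noteq> {}" "M \<noteq> {}" "M \<inter> N = {}" "convex M" "convex N"
      using MN ne disj cv by auto
    ultimately have "0 \<in> N"
      using zero_in_convex_symmetric by (metis ex_in_conv)
    \<comment> \<open>Otherwise 0 would lie in \<open>M\<close> as well as in \<open>N\<close>. So
      the reflection of \<open>M\<close> falls into \<open>N\<close>, and the symmetry of
      \<open>N\<close> then pulls \<open>M\<close> itself into \<open>N\<close>.\<close>
    have "\<not> (\<forall>x\<in>M. - x \<in> M)"
      using \<open>0 \<in> N\<close> \<open>M \<inter> N = {}\<close> \<open>M \<noteq> {}\<close> \<open>convex M\<close> zero_in_convex_symmetric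
      by (metis disjoint_iff ex_in_conv)
    then have "\<forall>x\<in>M. - x \<in> N"
      using cases[of M] MN by auto
    then have "M \<subseteq> N"
      using N by (metis minus_minus subsetI)
    with \<open>M \<noteq> {}\<close> \<open>M \<inter> N = {}\<close> show False
      by auto
  qed
  show ?thesis
    using half[of M1 M2] half[of M2 M1] by force
qed

section \<open>First entry of a ray into a closed set\<close>

text \<open>A relation rather than a function: a ray that misses \<open>M\<close> has no such
  \<open>t\<close>, so no default value arises.\<close>

definition first_hit :: "'a::euclidean_space set \<Rightarrow> 'a \<Rightarrow> real \<Rightarrow> bool" where
  "first_hit M w t \<longleftrightarrow> 0 \<le> t \<and> t *\<^sub>R w \<in> M \<and> (\<forall>s. 0 \<le> s \<and> s < t \<longrightarrow> s *\<^sub>R w \<notin> M)"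

text \<open>Shaped like \<open>collision_time\<close>, so that the two agree as soon as their index
  sets do.\<close>

definition hitting_time :: "'a::euclidean_space set \<Rightarrow> 'a \<Rightarrow> ereal" where
  "hitting_time M w = Inf (ereal ` {t. 0 \<le> t \<and> t *\<^sub>R w \<in> M})"

lemma first_hit_scaleR:
  assumes c: "c > 0"
  shows "first_hit M (c *\<^sub>R w) t \<longleftrightarrow> first_hit M w (t * c)"
proof -
  have "(\<forall>s. 0 \<le> s \<and> s < t \<longrightarrow> s *\<^sub>R c *\<^sub>R w \<notin> M) \<longleftrightarrow> (\<forall>s. 0 \<le> s \<and> s < t * c \<longrightarrow> s *\<^sub>R w \<notin> M)"
    (is "?L \<longleftrightarrow> ?R")
  proof
    assume L: ?L
    show ?R
    proof (intro allI impI)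
      fix s assume "0 \<le> s \<and> s < t * c"
      then show "s *\<^sub>R w \<notin> M"
        using L[rule_format, of "s / c"] c by (simp add: field_simps)
    qed
  next
    assume R: ?R
    then show ?L
      using c by auto
  qed
  then show ?thesis
    using c by (auto simp: first_hit_def zero_le_mult_iff)
qed

lemma hitting_time_eq:
  assumes "first_hit M w t" shows "hitting_time M w = ereal t"
  unfolding hitting_time_def
  using assms by (intro cInf_eq_minimum) (auto simp: first_hit_def not_less[symmetric])

lemma closed_scale_vimage:
  fixes M :: "'a::real_normed_vector set"
  assumes "closed M" shows "closed {t. t *\<^sub>R w \<in> M}"
  using closed_vimage[OF assms, of "\<lambda>t. t *\<^sub>R w"]
  by (simp add: vimage_def continuous_intros)

text \<open>Only times in the compact interval \<open>{0..s}\<close> matter, and closedness of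
  \<open>M\<close> gives a least one among them.\<close>

lemma first_hit_exists:
  assumes M: "closed M" and s: "0 \<le> s" "s *\<^sub>R w \<in> M"
  shows "\<exists>t\<le>s. first_hit M w t"
proof -
  have "compact ({0..s} \<inter> {t. t *\<^sub>R w \<in> M})"
    using closed_scale_vimage[OF M] by (intro compact_Int_closed) auto
  moreover have "s \<in> {0..s} \<inter> {t. t *\<^sub>R w \<in> M}"
    using s by simp
  ultimately obtain t where t: "t \<in> {0..s} \<inter> {t. t *\<^sub>R w \<in> M}"
      "\<forall>r\<in>{0..s} \<inter> {t. t *\<^sub>R w \<in> M}. t \<le> r"
    using compact_attains_inf[of "{0..s} \<inter> {t. t *\<^sub>R w \<in> M}"] by blast
  then have "first_hit M w t"
    by (force simp: first_hit_def)
  with t show ?thesis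
    by auto
qed

lemma hitting_time_finite_iff:
  assumes "closed M"
  shows "hitting_time M w < \<infinity> \<longleftrightarrow> (\<exists>t. first_hit M w t)"
proof
  assume "hitting_time M w < \<infinity>"
  then obtain t where "0 \<le> t" "t *\<^sub>R w \<in> M"
    unfolding hitting_time_def Inf_less_iff by auto
  then show "\<exists>t. first_hit M w t"
    using first_hit_exists[OF assms] by blast
qed (auto simp: hitting_time_eq)

lemma hitting_time_le_iff:
  assumes M: "closed M" and "0 \<le> a"
  shows "hitting_time M w \<le> ereal a \<longleftrightarrow> (\<exists>t\<in>{0..a}. t *\<^sub>R w \<in> M)"
proof
  assume le: "hitting_time M w \<le> ereal a"
  then have "hitting_time M w < \<infinity>"
    by (rule order.strict_trans1) simp
  then obtain t where "first_hit M w t"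
    using hitting_time_finite_iff[OF M] by auto
  with le show "\<exists>t\<in>{0..a}. t *\<^sub>R w \<in> M"
    by (auto simp: hitting_time_eq first_hit_def)
next
  assume "\<exists>t\<in>{0..a}. t *\<^sub>R w \<in> M"
  then show "hitting_time M w \<le> ereal a"
    by (auto simp: hitting_time_def intro!: Inf_lower2[of "ereal _"])
qed

text \<open>The projection of a closed set along the compact factor \<open>{0..a}\<close> is
  closed.\<close>

lemma closed_scale_union:
  fixes M :: "'a::euclidean_space set"
  assumes M: "closed M"
  shows "closed {w. \<exists>t\<in>{0..a}. t *\<^sub>R w \<in> M}"
proof -
  have "closed ((\<lambda>(t, w). t *\<^sub>R w) -` M :: (real \<times> 'a) set)"
    by (rule closed_vimage[OF M]) (auto simp: case_prod_unfold intro!: continuous_intros)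
  then have "closed {w. \<exists>t. t \<in> {0..a} \<and> (t, w) \<in> ((\<lambda>(t, w). t *\<^sub>R w) -` M)}"
    by (intro closed_compact_projection) auto
  then show ?thesis
    by (simp add: Bex_def)
qed

text \<open>The hitting time is lower semicontinuous: its infimum is attained when finite, which
  makes the sublevel sets closed.\<close>

lemma borel_measurable_hitting_time:
  fixes M :: "'a::euclidean_space set"
  assumes M: "closed M"
  shows "hitting_time M \<in> borel_measurable borel"
proof (rule borel_measurableI_le)
  fix y :: ereal
  have ge0: "0 \<le> hitting_time M w" for w
    by (auto simp: hitting_time_def intro: Inf_greatest)
  consider "y < 0" | "y = \<infinity>" | a where "y = ereal a" "0 \<le> a"
    by (cases y) (auto simp: not_less[symmetric])
  then show "{x \<in> space borel. hitting_time M x \<le> y} \<in> sets borel"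
  proof cases
    case 1
    then have "{x \<in> space borel. hitting_time M x \<le> y} = {}"
      using ge0 by (auto simp: not_le intro: less_le_trans)
    then show ?thesis by simp
  next
    case 3
    then show ?thesis
      using closed_scale_union[OF M, of a] by (simp add: hitting_time_le_iff[OF M])
  qed simp
qed

section \<open>Collision of a set with its reflection\<close>

context
  fixes M :: "'a::euclidean_space set"
  assumes closed: "closed M" and convex: "strictly_convex M" and zero: "0 \<notin> M"
begin

text \<open>A common point \<open>x + t v1 = - y + t v2\<close> makes \<open>t (v2 - v1) / 2\<close>
  the midpoint of \<open>x\<close> and \<open>y\<close>, which convexity keeps in \<open>M\<close>.
  Conversely this midpoint serves as both \<open>x\<close> and \<open>y\<close>.\<close>

lemma moved_meet_iff:
  "moved M v1 t \<inter> moved (uminus ` M) v2 t \<noteq> {} \<longleftrightarrow> t *\<^sub>R ((v2 - v1) /\<^sub>R 2) \<in> M"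
proof
  assume "moved M v1 t \<inter> moved (uminus ` M) v2 t \<noteq> {}"
  then obtain x y where xy: "x \<in> M" "y \<in> M" "x + t *\<^sub>R v1 = - y + t *\<^sub>R v2"
    by (auto simp: moved_def)
  then have sum: "t *\<^sub>R (v2 - v1) = x + y"
    by (simp add: algebra_simps)
  have "t *\<^sub>R ((v2 - v1) /\<^sub>R 2) = (1/2) *\<^sub>R (t *\<^sub>R (v2 - v1))"
    by simp
  also have "\<dots> = (1/2) *\<^sub>R x + (1/2) *\<^sub>R y"
    by (simp only: sum scaleR_add_right)
  finally have "t *\<^sub>R ((v2 - v1) /\<^sub>R 2) = (1/2) *\<^sub>R x + (1/2) *\<^sub>R y" .
  then show "t *\<^sub>R ((v2 - v1) /\<^sub>R 2) \<in> M"
    using convexD[OF strictly_convex_imp_convex[OF convex] xy(1,2), of "1/2" "1/2"] by simp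
next
  assume *: "t *\<^sub>R ((v2 - v1) /\<^sub>R 2) \<in> M" (is "?m \<in> M")
  have "?m + t *\<^sub>R v1 = - ?m + t *\<^sub>R v2"
    by (simp add: algebra_simps flip: scaleR_add_left)
  with * show "moved M v1 t \<inter> moved (uminus ` M) v2 t \<noteq> {}"
    unfolding moved_def by (metis (no_types, lifting) IntI empty_iff imageI)
qed

lemma collision_time_eq:
  "collision_time M (uminus ` M) v1 v2 = hitting_time M ((v2 - v1) /\<^sub>R 2)"
  by (simp only: collision_time_def hitting_time_def moved_meet_iff)

text \<open>Since \<open>0 \<notin> M\<close>, the first hit comes at a positive time, and a ball
  inside \<open>M\<close> around the hit point would allow an earlier one.\<close>

lemma first_hit_not_interior:
  assumes "first_hit M w t" shows "t *\<^sub>R w \<notin> interior M"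
proof
  assume "t *\<^sub>R w \<in> interior M"
  then obtain e where e: "e > 0" "ball (t *\<^sub>R w) e \<subseteq> M"
    by (meson mem_interior)
  have "t > 0" "w \<noteq> 0"
    using assms zero by (auto simp: first_hit_def le_less)
  \<comment> \<open>Going back by at most \<open>e / (2 * norm w)\<close> moves the point by at most
    \<open>e / 2\<close>; the maximum keeps the time nonnegative.\<close>
  define s where "s = max 0 (t - e / (2 * norm w))"
  have s: "0 \<le> s" "s < t" "t - s \<le> e / (2 * norm w)"
    using \<open>t > 0\<close> \<open>w \<noteq> 0\<close> e by (auto simp: s_def)
  have "dist (t *\<^sub>R w) (s *\<^sub>R w) = (t - s) * norm w"
    using s by (simp add: dist_norm flip: scaleR_diff_left)
  also have "\<dots> \<le> e / (2 * norm w) * norm w"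
    using s by (intro mult_right_mono) auto
  also have "\<dots> < e"
    using e \<open>w \<noteq> 0\<close> by simp
  finally have "s *\<^sub>R w \<in> M"
    using e by auto
  with s assms show False
    by (auto simp: first_hit_def)
qed

text \<open>Two distinct points \<open>x\<close>, \<open>y\<close> producing a contact would put
  their midpoint, the first hit point, into the interior of \<open>M\<close> by strict convexity. So
  \<open>x = y\<close>, which determines the contact point.\<close>

lemma collision_location_eq:
  assumes hit: "first_hit M ((v2 - v1) /\<^sub>R 2) t"
  shows "collision_location M (uminus ` M) v1 v2 = t *\<^sub>R ((v1 + v2) /\<^sub>R 2)"
proof -
  let ?m = "t *\<^sub>R ((v2 - v1) /\<^sub>R 2)" and ?c = "t *\<^sub>R ((v1 + v2) /\<^sub>R 2)"
  let ?X = "moved M v1 t \<inter> moved (uminus ` M) v2 t"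
  have sub: "?X \<subseteq> {?c}"
  proof
    fix z assume "z \<in> ?X"
    then obtain x y where xy: "x \<in> M" "y \<in> M" "z = x + t *\<^sub>R v1" "z = - y + t *\<^sub>R v2"
      by (auto simp: moved_def)
    have "x + y = t *\<^sub>R (v2 - v1)"
      using xy(3,4) by (simp add: algebra_simps)
    then have m: "?m = midpoint x y"
      by (simp add: midpoint_def)
    have "x = y"
    proof (rule ccontr)
      assume "x \<noteq> y"
      then have "?m \<in> open_segment x y"
        unfolding m by simp
      with convex xy \<open>x \<noteq> y\<close> have "?m \<in> interior M"
        unfolding strictly_convex_def by blast
      with first_hit_not_interior[OF hit] show False ..
    qed
    \<comment> \<open>Adding the two representations of \<open>z\<close> cancels \<open>x\<close>
      against \<open>- y\<close>.\<close>
    have "2 *\<^sub>R z = (x + t *\<^sub>R v1) + (- y + t *\<^sub>R v2)"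
      unfolding scaleR_2 by (rule arg_cong2[where f = "(+)", OF xy(3,4)])
    also have "\<dots> = t *\<^sub>R (v1 + v2)"
      using \<open>x = y\<close> by (simp add: algebra_simps)
    finally have "2 *\<^sub>R z = t *\<^sub>R (v1 + v2)" .
    then have "(1/2) *\<^sub>R 2 *\<^sub>R z = (1/2) *\<^sub>R t *\<^sub>R (v1 + v2)"
      by (rule arg_cong)
    then show "z \<in> {?c}"
      by simp
  qed
  moreover have "?X \<noteq> {}"
    using hit by (simp only: moved_meet_iff first_hit_def)
  ultimately have "?X = {?c}"
    by blast
  then show ?thesis
    unfolding collision_location_def collision_time_eq hitting_time_eq[OF hit] by simp
qed

section \<open>The collision event in velocity space\<close>

text \<open>Velocity pairs whose collision is located in \<open>B\<close>, phrased without the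
  definite description, so that measurability, scaling and rotation become accessible.\<close>

definition collision_event :: "'a set \<Rightarrow> ('a \<times> 'a) set" where
  "collision_event B = {(v1, v2). \<exists>t. first_hit M ((v2 - v1) /\<^sub>R 2) t \<and> t *\<^sub>R ((v1 + v2) /\<^sub>R 2) \<in> B}"

lemma collision_event_iff:
  "(v1, v2) \<in> collision_event B \<longleftrightarrow>
     collision_time M (uminus ` M) v1 v2 < \<infinity> \<and> collision_location M (uminus ` M) v1 v2 \<in> B"
  unfolding collision_time_eq hitting_time_finite_iff[OF closed] collision_event_def
  by (auto simp: collision_location_eq)

lemma collision_event_sets:
  assumes [measurable]: "B \<in> sets borel" shows "collision_event B \<in> sets borel"
proof -
  note [measurable] = borel_measurable_hitting_time[OF closed]
  let ?h = "\<lambda>p :: 'a \<times> 'a. hitting_time M ((snd p - fst p) /\<^sub>R 2)"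
  \<comment> \<open>When finite, \<open>hitting_time\<close> is the unique first hit, so the
    existential gives way to a measurable expression.\<close>
  have "collision_event B =
      {p. ?h p < \<infinity> \<and> real_of_ereal (?h p) *\<^sub>R ((fst p + snd p) /\<^sub>R 2) \<in> B}"
    unfolding collision_event_def hitting_time_finite_iff[OF closed]
    by (auto simp: hitting_time_eq)
  also have "\<dots> = {p \<in> space (borel \<Otimes>\<^sub>M borel).
      ?h p < \<infinity> \<and> real_of_ereal (?h p) *\<^sub>R ((fst p + snd p) /\<^sub>R 2) \<in> B}"
    by (simp add: space_pair_measure)
  also have "\<dots> \<in> sets (borel \<Otimes>\<^sub>M borel)"
    by measurable
  finally show ?thesis
    by (simp only: borel_prod)
qed

text \<open>Speeding up both bodies by \<open>c\<close> divides the collision time by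
  \<open>c\<close> and leaves the location fixed. Hence the event depends on the direction of the
  velocity pair alone.\<close>

lemma collision_event_scaleR:
  assumes "c > 0" shows "c *\<^sub>R p \<in> collision_event B \<longleftrightarrow> p \<in> collision_event B"
proof (cases p)
  case (Pair v1 v2)
  have eq: "(c *\<^sub>R v2 - c *\<^sub>R v1) /\<^sub>R 2 = c *\<^sub>R ((v2 - v1) /\<^sub>R 2)"
    "t *\<^sub>R ((c *\<^sub>R v1 + c *\<^sub>R v2) /\<^sub>R 2) = (t * c) *\<^sub>R ((v1 + v2) /\<^sub>R 2)" for t
    by (simp_all add: algebra_simps)
  have "c *\<^sub>R p \<in> collision_event B \<longleftrightarrow>
      (\<exists>t. first_hit M ((v2 - v1) /\<^sub>R 2) (t * c) \<and> (t * c) *\<^sub>R ((v1 + v2) /\<^sub>R 2) \<in> B)"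
    by (simp only: Pair scaleR_Pair collision_event_def mem_Collect_eq case_prod_conv eq
        first_hit_scaleR[OF assms])
  \<comment> \<open>A hitting time \<open>r\<close> for \<open>p\<close> is reached with the witness
    \<open>t = r / c\<close>.\<close>
  also have "\<dots> \<longleftrightarrow> p \<in> collision_event B"
    unfolding Pair collision_event_def mem_Collect_eq case_prod_conv
    using assms by (metis nonzero_divide_eq_eq less_irrefl)
  finally show ?thesis .
qed

lemma collision_event_normalize:
  "p /\<^sub>R norm p \<in> collision_event B \<longleftrightarrow> p \<in> collision_event B"
  using collision_event_scaleR[of "inverse (norm p)" p B] by (cases "p = 0") auto

lemma emeasure_collision_event_rotation:
  assumes g: "orthogonal_transformation g" and B: "B \<in> sets borel"
  shows "emeasure uniform_sphere (collision_event (g -` B)) = emeasure uniform_sphere (collision_event B)"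
proof -
  have lin: "linear g" and norm: "norm (g x) = norm x" for x
    using g by (auto simp: orthogonal_transformation)
  \<comment> \<open>In the coordinates \<open>p = (s - w, s + w)\<close>, this map sends
    \<open>s\<close> to \<open>g s\<close> and fixes \<open>w\<close>. By the parallelogram law the
    squared norm of \<open>p\<close> is twice the sum of those of \<open>s\<close> and
    \<open>w\<close>, so it is preserved.\<close>
  define \<Phi> :: "'a \<times> 'a \<Rightarrow> 'a \<times> 'a" where
    "\<Phi> p = (g ((fst p + snd p) /\<^sub>R 2) - (snd p - fst p) /\<^sub>R 2,
            g ((fst p + snd p) /\<^sub>R 2) + (snd p - fst p) /\<^sub>R 2)" for p
  have half: "u /\<^sub>R 2 + u /\<^sub>R 2 = u" for u :: 'a
    by (simp flip: scaleR_add_left)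
  have parallelogram: "(norm (a - b))\<^sup>2 + (norm (a + b))\<^sup>2 = 2 * (norm a)\<^sup>2 + 2 * (norm b)\<^sup>2" for a b :: 'a
    by (simp add: power2_norm_eq_inner inner_simps inner_commute)
  have "linear \<Phi>"
    by (rule linearI)
      (simp_all add: \<Phi>_def linear_add[OF lin] linear_diff[OF lin] linear_cmul[OF lin] algebra_simps)
  moreover have "norm (\<Phi> p) = norm p" for p
  proof -
    define s w where "s = (fst p + snd p) /\<^sub>R 2" and "w = (snd p - fst p) /\<^sub>R 2"
    have p: "p = (s - w, s + w)"
      using half[of "fst p"] half[of "snd p"]
      by (intro prod_eqI) (simp_all add: s_def w_def algebra_simps)
    have "(norm (\<Phi> p))\<^sup>2 = (norm (g s - w))\<^sup>2 + (norm (g s + w))\<^sup>2"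
      by (simp add: \<Phi>_def s_def w_def norm_Pair)
    also have "\<dots> = (norm (s - w))\<^sup>2 + (norm (s + w))\<^sup>2"
      by (simp add: parallelogram norm)
    also have "\<dots> = (norm p)\<^sup>2"
      by (simp add: p norm_Pair)
    finally show ?thesis
      by simp
  qed
  ultimately have \<Phi>: "orthogonal_transformation \<Phi>"
    by (simp add: orthogonal_transformation)
  have mean: "(fst (\<Phi> p) + snd (\<Phi> p)) /\<^sub>R 2 = g ((fst p + snd p) /\<^sub>R 2)" for p
    by (simp add: \<Phi>_def flip: scaleR_2)
  have rel: "(snd (\<Phi> p) - fst (\<Phi> p)) /\<^sub>R 2 = (snd p - fst p) /\<^sub>R 2" for p
    by (simp add: \<Phi>_def flip: scaleR_2)
  \<comment> \<open>The first hit depends on \<open>w\<close> and is unchanged, while linearity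
    turns \<open>t\<close> times \<open>g s\<close> into \<open>g\<close> of the old
    location.\<close>
  have "collision_event (g -` B) = \<Phi> -` collision_event B"
    by (simp only: collision_event_def vimage_def case_prod_unfold mem_Collect_eq mean rel
        linear_cmul[OF lin])
  then show ?thesis
    by (simp add: emeasure_uniform_sphere_orthogonal_vimage[OF \<Phi> collision_event_sets[OF B]])
qed

section \<open>The conditional distribution of the collision location\<close>

lemma rotation_invariant_collision_location:
  fixes P :: "'w measure" and V1 V2 :: "'w \<Rightarrow> 'a"
  assumes V [measurable]: "V1 \<in> borel_measurable P" "V2 \<in> borel_measurable P"
    and unif: "distr P borel (\<lambda>\<omega>. (V1 \<omega>, V2 \<omega>) /\<^sub>R norm (V1 \<omega>, V2 \<omega>)) = uniform_sphere"
  shows "rotation_invariant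
           (cond_distr P {\<omega> \<in> space P. collision_time M (uminus ` M) (V1 \<omega>) (V2 \<omega>) < \<infinity>}
              (\<lambda>\<omega>. collision_location M (uminus ` M) (V1 \<omega>) (V2 \<omega>)))"
proof -
  let ?A = "{\<omega> \<in> space P. collision_time M (uminus ` M) (V1 \<omega>) (V2 \<omega>) < \<infinity>}"
  let ?C = "\<lambda>\<omega>. collision_location M (uminus ` M) (V1 \<omega>) (V2 \<omega>)"
  let ?V = "\<lambda>\<omega>. (V1 \<omega>, V2 \<omega>)"
  have Vm: "?V \<in> borel_measurable P"
    by (simp add: borel_prod[symmetric])
  have meas: "?V -` collision_event B \<inter> space P \<in> sets P" if "B \<in> sets borel" for B
    by (rule measurable_sets[OF Vm collision_event_sets[OF that]])
  have ev: "?A \<inter> ?C -` B = ?V -` collision_event B \<inter> space P" for B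
    by (auto simp: collision_event_iff)
  have A: "?A \<in> sets P"
    using meas[of UNIV] ev[of UNIV] by simp
  have C: "?C \<in> borel_measurable P"
  proof -
    \<comment> \<open>Without a collision the infinite time is read as the real 0, when the sets are
      disjoint. The description is then of the form \<open>THE c. False\<close>, so the location is
      constant off the event, which gives measurability on all of \<open>P\<close>.\<close>
    define c where "c = (THE c::'a. False)"
    have default: "?C \<omega> = c" if "\<omega> \<in> space P - ?A" for \<omega>
    proof -
      have T: "collision_time M (uminus ` M) (V1 \<omega>) (V2 \<omega>) = \<infinity>"
        using that by auto
      have "moved M (V1 \<omega>) 0 \<inter> moved (uminus ` M) (V2 \<omega>) 0 = {}"
        using zero moved_meet_iff[of "V1 \<omega>" 0 "V2 \<omega>"] by auto
      then show ?thesis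
        by (simp add: collision_location_def T c_def)
    qed
    show ?thesis
    proof (rule measurableI)
      fix B :: "'a set" assume B: "B \<in> sets borel"
      have "?C -` B \<inter> space P = (?A \<inter> ?C -` B) \<union> (if c \<in> B then space P - ?A else {})"
        using default by auto
      also have "\<dots> \<in> sets P"
        unfolding ev using meas[OF B] A by auto
      finally show "?C -` B \<inter> space P \<in> sets P" .
    qed simp
  qed
  \<comment> \<open>The denominator does not depend on \<open>B\<close>, so invariance reduces to
    the mass of \<open>collision_event B\<close> under \<open>uniform_sphere\<close>.\<close>
  have em: "emeasure (cond_distr P ?A ?C) B
      = emeasure uniform_sphere (collision_event B) / emeasure P ?A" if B: "B \<in> sets borel" for B
  proof -
    have "emeasure (cond_distr P ?A ?C) B = emeasure (uniform_measure P ?A) (?C -` B \<inter> space P)"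
      using C B by (simp add: cond_distr_def emeasure_distr)
    also have "\<dots> = emeasure P (?A \<inter> (?C -` B \<inter> space P)) / emeasure P ?A"
      using A measurable_sets[OF C B] by (simp add: emeasure_uniform_measure)
    also have "?A \<inter> (?C -` B \<inter> space P) = ?V -` collision_event B \<inter> space P"
      using ev[of B] by blast
    \<comment> \<open>Scale invariance allows the velocity pair to be normalized, and only the law
      of the normalized pair is known.\<close>
    also have "\<dots> = (\<lambda>\<omega>. ?V \<omega> /\<^sub>R norm (?V \<omega>)) -` collision_event B \<inter> space P"
      using collision_event_normalize by blast
    also have "emeasure P \<dots> = emeasure uniform_sphere (collision_event B)"
      unfolding unif[symmetric]
      using Vm by (intro emeasure_distr[symmetric] collision_event_sets B) measurable
    finally show ?thesis .
  qed
  show ?thesis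
    unfolding rotation_invariant_def
  proof (intro allI impI measure_eqI)
    fix g :: "'a \<Rightarrow> 'a" assume g: "orthogonal_transformation g"
    have gm: "g \<in> borel_measurable borel"
      using g by (rule borel_measurable_orthogonal_transformation)
    show "sets (distr (cond_distr P ?A ?C) borel g) = sets (cond_distr P ?A ?C)"
      by (simp add: cond_distr_def)
    fix B assume "B \<in> sets (distr (cond_distr P ?A ?C) borel g)"
    then have B: "B \<in> sets borel"
      by simp
    have gB: "g -` B \<in> sets borel"
      using measurable_sets_borel[OF gm B] by simp
    have "emeasure (distr (cond_distr P ?A ?C) borel g) B = emeasure (cond_distr P ?A ?C) (g -` B)"
      using gm B by (subst emeasure_distr) (auto simp: cond_distr_def)
    also have "\<dots> = emeasure (cond_distr P ?A ?C) B"
      by (simp only: em[OF B] em[OF gB] emeasure_collision_event_rotation[OF g B])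
    finally show "emeasure (distr (cond_distr P ?A ?C) borel g) B = emeasure (cond_distr P ?A ?C) B" .
  qed
qed

end

section \<open>Empty sets and the conclusion\<close>

lemma rotation_invariant_null:
  fixes \<mu> :: "'a::euclidean_space measure"
  assumes "sets \<mu> = sets borel" "emeasure \<mu> (space \<mu>) = 0"
  shows "rotation_invariant \<mu>"
proof -
  have null: "emeasure \<mu> B = 0" for B
    by (metis assms(2) emeasure_space le_zero_eq)
  have "g \<in> measurable \<mu> borel" if "orthogonal_transformation g" for g :: "'a \<Rightarrow> 'a"
    using borel_measurable_orthogonal_transformation[OF that]
    by (simp add: measurable_cong_sets[OF assms(1) refl])
  then show ?thesis
    unfolding rotation_invariant_def
    by (intro allI impI measure_eqI) (auto simp: assms(1) null emeasure_distr)
qed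

theorem theorem2p1:
  fixes M1 M2 :: "(real ^ 'd) set"
    and P :: "'w measure"
    and V1 V2 :: "'w \<Rightarrow> real ^ 'd"
  assumes "closed M1" and "closed M2"
    and "M1 \<inter> M2 = {}"
    and "strictly_convex M1" and "strictly_convex M2"
    and "\<And>x. x \<in> M1 \<union> M2 \<longleftrightarrow> - x \<in> M1 \<union> M2"
    and "prob_space P"
    and "V1 \<in> measurable P borel" and "V2 \<in> measurable P borel"
    and "distr P borel (\<lambda>\<omega>. (V1 \<omega>, V2 \<omega>) /\<^sub>R norm (V1 \<omega>, V2 \<omega>)) = uniform_sphere"
  shows "rotation_invariant
           (cond_distr P {\<omega> \<in> space P. collision_time M1 M2 (V1 \<omega>) (V2 \<omega>) < \<infinity>}
              (\<lambda>\<omega>. collision_location M1 M2 (V1 \<omega>) (V2 \<omega>)))"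
proof (cases "M1 = {} \<or> M2 = {}")
  case True
  then have disjoint: "moved M1 v1 t \<inter> moved M2 v2 t = {}" for v1 v2 t
    by (auto simp: moved_def)
  \<comment> \<open>If a set is empty, no collision ever occurs; conditioning on the empty event
    yields the null measure.\<close>
  have "rotation_invariant (distr (uniform_measure P {}) borel (\<lambda>_. THE c. False) :: (real^'d) measure)"
    by (intro rotation_invariant_null) (auto simp: emeasure_distr)
  moreover have "collision_time M1 M2 v1 v2 = \<infinity>" "collision_location M1 M2 v1 v2 = (THE c. False)" for v1 v2
    by (simp_all add: disjoint collision_time_def collision_location_def top_ereal_def)
  ultimately show ?thesis
    by (simp add: cond_distr_def)
next
  case False
  then have M2: "M2 = uminus ` M1"
    using assms by (intro centrally_symmetric_union_cases strictly_convex_imp_convex) auto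
  \<comment> \<open>The point 0 equals its own reflection and would lie in both disjoint
    sets.\<close>
  have "0 \<notin> M1"
    using \<open>M1 \<inter> M2 = {}\<close> unfolding M2 by force
  show ?thesis
    unfolding M2 using assms \<open>0 \<notin> M1\<close> by (intro rotation_invariant_collision_location) auto
qed

end
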